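(* For each integer $n\ge 3$ let $e_2(n)$ be the minimum number of edges of a graph of order $n$ whose rainbow connection number equals $2$. Then $$\lim_{n\rightarrow\infty}\frac{e_2(n)}{n\log_2 n}=1.$$
   Context: All graphs are undirected, finite and simple; $e(G)$ denotes the number of edges of $G$. Edge-colorings are arbitrary: adjacent edges may receive the same color. A path in an edge-colored graph is a rainbow path if no two of its edges have the same color. The rainbow connection number $rc(G)$ of a connected graph $G$ is the minimum integer $i$ for which there exists an edge-coloring of $G$ with $i$ colors such that every two distinct vertices of $G$ are connected by a rainbow path. For natural numbers $d<n$, $\mathcal{G}_d(n)$ denotes the set of all graphs of order $n$ with rainbow connection number $d$, and $e_d(n)=\min\{e(G) : G\in\mathcal{G}_d(n)\}$. *)

theory Defs
  imports Complex_Main "Graph_Theory.Graph_Theory"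
begin

text \<open>A finite simple undirected graph is a \<^locale>\<open>pair_graph\<close>: an irreflexive symmetric set of
  ordered pairs. Each undirected edge thus corresponds to two opposite arcs; edges are counted and
  coloured as unordered pairs, so that both arcs count once and carry the same colour.\<close>

definition edge_of :: "'a \<times> 'a \<Rightarrow> 'a set" where
  "edge_of a = {fst a, snd a}"

definition uedges :: "'a pair_pre_digraph \<Rightarrow> 'a set set" where
  "uedges G = edge_of ` parcs G"

definition num_edges :: "'a pair_pre_digraph \<Rightarrow> nat" where
  "num_edges G = card (uedges G)"

definition rainbow_path :: "'a pair_pre_digraph \<Rightarrow> ('a set \<Rightarrow> nat) \<Rightarrow> 'a list \<Rightarrow> bool" where
  "rainbow_path G c p \<longleftrightarrow>
     vpath p (with_proj G) \<and> distinct (map (\<lambda>a. c (edge_of a)) (vwalk_arcs p))"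

definition rainbow_coloring :: "'a pair_pre_digraph \<Rightarrow> nat \<Rightarrow> ('a set \<Rightarrow> nat) \<Rightarrow> bool" where
  "rainbow_coloring G i c \<longleftrightarrow>
     c ` uedges G \<subseteq> {..<i} \<and>
     (\<forall>u \<in> pverts G. \<forall>v \<in> pverts G. u \<noteq> v \<longrightarrow>
        (\<exists>p. rainbow_path G c p \<and> hd p = u \<and> last p = v))"

text \<open>Only meaningful for connected \<open>G\<close>; otherwise no \<open>i\<close> qualifies.\<close>

definition rc :: "'a pair_pre_digraph \<Rightarrow> nat" where
  "rc G = (LEAST i. \<exists>c. rainbow_coloring G i c)"

text \<open>Vertices are drawn from \<^typ>\<open>nat\<close>, which covers every finite graph up to isomorphism.\<close>

definition rc_graphs :: "nat \<Rightarrow> nat \<Rightarrow> nat pair_pre_digraph set" where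
  "rc_graphs d n =
     {G. pair_graph G \<and> Digraph_Component.connected (with_proj G) \<and> card (pverts G) = n \<and> rc G = d}"

text \<open>The value is unspecified if \<open>rc_graphs d n\<close> is empty.\<close>

definition min_edges_rc :: "nat \<Rightarrow> nat \<Rightarrow> nat" where
  "min_edges_rc d n = (LEAST m. \<exists>G \<in> rc_graphs d n. num_edges G = m)"

end

theory Submission
  imports Defs "HOL-Real_Asymp.Real_Asymp"
begin

text \<open>Upper bound: join about \<open>log 2 n\<close> hubs to each other and to all other vertices, and give the
  other vertices distinct binary codes; two of them are joined by a rainbow path through a hub at
  which their codes differ.

  Lower bound: if there are at most \<open>n log 2 n\<close> edges, all but \<open>o(n)\<close> vertices have polylogarithmic
  degree. A low-degree vertex reaches only polylogarithmically many others by a path of length at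
  most two avoiding the high-degree vertices, so nearly all pairs of low-degree vertices are
  separated by the two colour classes at some high-degree vertex. Hansel's covering argument then
  forces about \<open>log 2 n\<close> edges from the average low-degree vertex to the high-degree ones. Counting
  only these edges avoids the factor two lost in the degree sum.\<close>

section \<open>Hansel's inequality\<close>

text \<open>For each \<open>h\<close> delete \<open>A h\<close> or \<open>B h\<close> from
  \<open>L\<close> by a fair coin. The survivors are separated by no \<open>h\<close>, so there are
  at most \<open>K\<close> of them, and the sum is their expected number. The induction averages
  over the choice at one \<open>h\<close>.\<close>

lemma sum_half_power_le_of_unseparated_small:
  fixes A B :: "'h \<Rightarrow> 'v set"
  assumes "finite H" "finite L"
    and "\<And>h. h \<in> H \<Longrightarrow> A h \<inter> B h = {}"
    and "\<And>S. S \<subseteq> L \<Longrightarrow> (\<And>h. h \<in> H \<Longrightarrow> S \<inter> A h = {} \<or> S \<inter> B h = {}) \<Longrightarrow> card S \<le> K"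
  shows "(\<Sum>v\<in>L. (1/2) ^ card {h \<in> H. v \<in> A h \<union> B h}) \<le> real K"
  using assms
proof (induction H arbitrary: L rule: finite_induct)
  case empty
  have "card L \<le> K"
    by (rule empty.prems(3)) auto
  then show ?case by simp
next
  case (insert x H)
  define d where "d v = card {h \<in> H. v \<in> A h \<union> B h}" for v
  have d_insert: "card {h \<in> insert x H. v \<in> A h \<union> B h} = (if v \<in> A x \<union> B x then Suc (d v) else d v)" for v
  proof -
    have "{h \<in> insert x H. v \<in> A h \<union> B h} =
        (if v \<in> A x \<union> B x then insert x {h \<in> H. v \<in> A h \<union> B h} else {h \<in> H. v \<in> A h \<union> B h})"
      by auto
    then show ?thesis
      using insert.hyps unfolding d_def by (auto simp: card_insert_if)
  qed
  have le_A: "(\<Sum>v\<in>L - A x. (1/2) ^ d v) \<le> real K"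
    unfolding d_def
  proof (rule insert.IH)
    fix S assume S: "S \<subseteq> L - A x" "\<And>h. h \<in> H \<Longrightarrow> S \<inter> A h = {} \<or> S \<inter> B h = {}"
    show "card S \<le> K"
      by (rule insert.prems(3)) (use S in auto)
  qed (use insert.prems in auto)
  have le_B: "(\<Sum>v\<in>L - B x. (1/2) ^ d v) \<le> real K"
    unfolding d_def
  proof (rule insert.IH)
    fix S assume S: "S \<subseteq> L - B x" "\<And>h. h \<in> H \<Longrightarrow> S \<inter> A h = {} \<or> S \<inter> B h = {}"
    show "card S \<le> K"
      by (rule insert.prems(3)) (use S in auto)
  qed (use insert.prems in auto)
  have disj: "A x \<inter> B x = {}"
    using insert.prems(2) by simp
  have diff: "(\<Sum>v\<in>L - X. (1/2) ^ d v) = (\<Sum>v\<in>L. if v \<in> X then 0 else (1/2::real) ^ d v)" for X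
    by (rule sum.mono_neutral_cong_left) (use insert.prems(1) in auto)
  \<comment> \<open>A vertex outside \<open>A x\<close> and \<open>B x\<close> survives both
    deletions, any other exactly one, as the two sets are disjoint.\<close>
  have "2 * (\<Sum>v\<in>L. (1/2) ^ card {h \<in> insert x H. v \<in> A h \<union> B h})
      = (\<Sum>v\<in>L - A x. (1/2) ^ d v) + (\<Sum>v\<in>L - B x. (1/2::real) ^ d v)"
    unfolding diff d_insert sum.distrib[symmetric] sum_distrib_left
  proof (rule sum.cong)
    fix v
    show "2 * (1/2) ^ (if v \<in> A x \<union> B x then Suc (d v) else d v) =
        (if v \<in> A x then 0 else (1/2::real) ^ d v) + (if v \<in> B x then 0 else (1/2) ^ d v)"
      using disj by (cases "v \<in> A x"; cases "v \<in> B x") auto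
  qed simp
  with le_A le_B show ?case by linarith
qed

text \<open>The tangent of \<open>t \<mapsto> 2 powr (- t)\<close> at \<open>log 2 (card L / K)\<close> replaces Jensen's inequality.\<close>

lemma sum_ge_log_of_sum_half_power_le:
  fixes d :: "'v \<Rightarrow> nat"
  assumes "finite L" "L \<noteq> {}" "K > 0" and le: "(\<Sum>v\<in>L. (1/2) ^ d v) \<le> (K::real)"
  shows "real (card L) * log 2 (real (card L) / K) \<le> real (\<Sum>v\<in>L. d v)"
proof -
  define l where "l = real (card L)"
  have l: "l > 0" using assms by (simp add: l_def card_gt_0_iff)
  define a where "a = log 2 (l / K)"
  \<comment> \<open>Here \<open>K / l\<close> is \<open>2 powr (- a)\<close>, and the bound is
    \<open>1 + y \<le> exp y\<close> at \<open>y = - (k - a) * ln 2\<close>, scaled by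
    \<open>K / l\<close>.\<close>
  have tangent: "K / l * (1 - (real k - a) * ln 2) \<le> (1/2) ^ k" for k :: nat
  proof -
    have "K / l = exp (- a * ln 2)"
      using l \<open>K > 0\<close> by (simp add: a_def log_def exp_minus)
    moreover have "(1/2::real) ^ k = exp (- real k * ln 2)"
      by (simp add: exp_minus exp_of_nat_mult power_one_over inverse_eq_divide)
    moreover have "exp (- real k * ln 2) = exp (- a * ln 2) * exp (- (real k - a) * ln 2)"
      by (simp add: exp_add[symmetric] algebra_simps)
    moreover have "1 - (real k - a) * ln 2 \<le> exp (- (real k - a) * ln 2)"
      using exp_ge_add_one_self[of "- (real k - a) * ln 2"] by (simp add: algebra_simps)
    ultimately show ?thesis
      by (simp add: mult_left_mono)
  qed
  have "l - (real (\<Sum>v\<in>L. d v) - l * a) * ln 2 = (\<Sum>v\<in>L. 1 - (real (d v) - a) * ln 2)"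
    by (simp add: sum_subtractf sum_distrib_right[symmetric] l_def)
  then have "K / l * (l - (real (\<Sum>v\<in>L. d v) - l * a) * ln 2)
      = (\<Sum>v\<in>L. K / l * (1 - (real (d v) - a) * ln 2))"
    by (simp only: sum_distrib_left)
  also have "\<dots> \<le> K"
    using sum_mono[of L, OF tangent] le by (rule order_trans)
  finally have "K * (l - (real (\<Sum>v\<in>L. d v) - l * a) * ln 2) \<le> K * l"
    using l by (simp add: field_simps)
  then have "0 \<le> (real (\<Sum>v\<in>L. d v) - l * a) * ln 2"
    using \<open>K > 0\<close> by simp
  then have "l * a \<le> real (\<Sum>v\<in>L. d v)"
    by (simp add: zero_le_mult_iff)
  then show ?thesis by (simp add: a_def l_def)
qed

section \<open>Rainbow colourings\<close>

text \<open>The arcs carry different colours out of \<open>i\<close>, and a path has one vertex more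
  than it has arcs.\<close>

lemma rainbow_path_length:
  assumes "rainbow_path G c p" "c ` uedges G \<subseteq> {..<i}"
  shows "length p \<le> Suc i"
proof -
  let ?cs = "map (\<lambda>a. c (edge_of a)) (vwalk_arcs p)"
  have "set (vwalk_arcs p) \<subseteq> parcs G" "distinct ?cs"
    using assms(1) by (auto simp: rainbow_path_def vpath_def vwalk_def)
  then have "set ?cs \<subseteq> {..<i}"
    using assms(2) by (auto simp: uedges_def)
  with \<open>distinct ?cs\<close> have "length ?cs \<le> i"
    by (metis card_lessThan card_mono distinct_card finite_lessThan)
  then show ?thesis
    using vwalk_length_simp[of p, unfolded vwalk_length_def] by simp
qed

lemma rainbow_path_pair:
  assumes "(u, v) \<in> parcs G" "pair_graph G"
  shows "rainbow_path G c [u, v]"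
proof -
  interpret pair_graph G by fact
  show ?thesis
    using assms(1)
    by (auto simp: rainbow_path_def vpath_def vwalk_def dest: in_arcsD1 in_arcsD2 no_loops')
qed

lemma rainbow_path_triple:
  assumes "(u, w) \<in> parcs G" "(w, v) \<in> parcs G" "u \<noteq> v" "c {u, w} \<noteq> c {w, v}" "pair_graph G"
  shows "rainbow_path G c [u, w, v]"
proof -
  interpret pair_graph G by fact
  show ?thesis
    using assms(1-4)
    by (auto simp: rainbow_path_def vpath_def vwalk_def edge_of_def dest: in_arcsD1 in_arcsD2 no_loops')
qed

text \<open>Two colours allow at most three vertices on a rainbow path. A nonadjacent pair is thus
  separated by the colours at a common neighbour, which is how the lower bound uses the
  colouring.\<close>

lemma rainbow_coloring_2D:
  assumes "rainbow_coloring G 2 c" "u \<in> pverts G" "v \<in> pverts G" "u \<noteq> v"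
  shows "(u, v) \<in> parcs G \<or>
    (\<exists>w. (u, w) \<in> parcs G \<and> (w, v) \<in> parcs G \<and> c {u, w} \<noteq> c {w, v})"
proof -
  obtain p where p: "rainbow_path G c p" "hd p = u" "last p = v"
    using assms unfolding rainbow_coloring_def by blast
  have "length p \<le> 3"
    using rainbow_path_length[OF p(1)] assms(1) by (simp add: rainbow_coloring_def numeral_eq_Suc)
  moreover have "p \<noteq> []"
    using p(1) by (auto simp: rainbow_path_def)
  ultimately consider "p = [u]" | "p = [u, v]" | w where "p = [u, w, v]"
    using p(2,3)
    by (cases p rule: remdups_adj.cases; cases "tl (tl p)") (auto split: if_splits)
  then show ?thesis
    using p assms(4) by cases (auto simp: rainbow_path_def vpath_def vwalk_def edge_of_def)
qed

text \<open>With fewer than two colours a rainbow path has at most one edge. This excludes values of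
  \<open>rc\<close> below 2 for the construction.\<close>

lemma rainbow_coloring_small_complete:
  assumes "rainbow_coloring G i c" "i < 2" "u \<in> pverts G" "v \<in> pverts G" "u \<noteq> v"
  shows "(u, v) \<in> parcs G"
proof -
  obtain p where p: "rainbow_path G c p" "hd p = u" "last p = v"
    using assms unfolding rainbow_coloring_def by blast
  have "length p \<le> 2"
    using rainbow_path_length[OF p(1)] assms(1,2) by (fastforce simp: rainbow_coloring_def)
  moreover have "p \<noteq> []"
    using p(1) by (auto simp: rainbow_path_def)
  ultimately have "p = [u, v]"
    using p(2,3) assms(5) by (cases p rule: remdups_adj.cases) auto
  then show ?thesis
    using p by (auto simp: rainbow_path_def vpath_def vwalk_def)
qed

text \<open>The first vertex lies on the first edge and on no later one. Distinct arcs alone would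
  not suffice, since opposite arcs have the same edge.\<close>

lemma distinct_edges_of_distinct:
  "distinct p \<Longrightarrow> distinct (map edge_of (vwalk_arcs p))"
proof (induction p rule: vwalk_arcs.induct)
  case (3 x y xs)
  have "x \<in> edge_of (x, y)" by (simp add: edge_of_def)
  moreover have "x \<notin> edge_of a" if "a \<in> set (vwalk_arcs (y # xs))" for a
  proof -
    have "fst a \<in> set (y # xs)" "snd a \<in> set (y # xs)"
      using that by (induction "y # xs" arbitrary: y xs rule: vwalk_arcs.induct) auto
    with "3.prems" show ?thesis by (auto simp: edge_of_def)
  qed
  ultimately have "edge_of (x, y) \<notin> edge_of ` set (vwalk_arcs (y # xs))"
    by auto
  with 3 show ?case by auto
qed auto

lemma connected_imp_vpath:
  assumes "pair_graph G" "Digraph_Component.connected (with_proj G)"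
    "u \<in> pverts G" "v \<in> pverts G"
  obtains p where "vpath p (with_proj G)" "hd p = u" "last p = v"
proof -
  interpret pair_graph G by fact
  have "strongly_connected (with_proj G)"
    using symmetric_connected_imp_strongly_connected sym_arcs assms(2) by blast
  then have "reachable (with_proj G) u v"
    using assms(3,4) by auto
  then show ?thesis
    using reachable_vpath_conv that by auto
qed

text \<open>Give every edge its own colour: any path without repeated vertices is then rainbow. So
  the minimum defining \<open>rc\<close> is attained.\<close>

lemma ex_rainbow_coloring:
  assumes "pair_graph G" "Digraph_Component.connected (with_proj G)"
  shows "\<exists>i c. rainbow_coloring G i c"
proof -
  interpret pair_graph G by fact
  have "finite (uedges G)"
    by (simp add: uedges_def)
  then obtain i and c :: "'a set \<Rightarrow> nat"
    where c: "c ` uedges G = {j. j < i}" "inj_on c (uedges G)"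
    using finite_imp_inj_to_nat_seg by metis
  have "\<exists>p. rainbow_path G c p \<and> hd p = u \<and> last p = v"
    if uv: "u \<in> pverts G" "v \<in> pverts G" for u v
  proof -
    obtain p where p: "vpath p (with_proj G)" "hd p = u" "last p = v"
      using connected_imp_vpath[OF assms uv] .
    have "set (map edge_of (vwalk_arcs p)) \<subseteq> uedges G"
      using p(1) by (auto simp: vpath_def vwalk_def uedges_def)
    moreover have "distinct (map edge_of (vwalk_arcs p))"
      using p(1) by (intro distinct_edges_of_distinct) auto
    ultimately have "distinct (map c (map edge_of (vwalk_arcs p)))"
      using inj_on_subset[OF c(2)] by (simp only: distinct_map)
    with p show ?thesis
      by (auto simp: rainbow_path_def comp_def)
  qed
  with c have "rainbow_coloring G i c"
    by (auto simp: rainbow_coloring_def)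
  then show ?thesis by blast
qed

lemma rc_eq_2D:
  assumes "pair_graph G" "Digraph_Component.connected (with_proj G)" "rc G = 2"
  obtains c where "rainbow_coloring G 2 c"
  using LeastI_ex[OF ex_rainbow_coloring[OF assms(1,2)]] assms(3) by (auto simp: rc_def)

section \<open>The lower bound\<close>

lemma finite_uedges:
  assumes "pair_graph G"
  shows "finite (uedges G)"
proof -
  interpret pair_graph G by fact
  show ?thesis by (simp add: uedges_def)
qed

lemma edge_of_eq_iff: "edge_of a = edge_of b \<longleftrightarrow> a = b \<or> a = (snd b, fst b)"
  by (cases a; cases b) (simp add: edge_of_def doubleton_eq_iff)

lemma card_parcs_le:
  assumes "pair_graph G"
  shows "card (parcs G) \<le> 2 * num_edges G"
proof -
  interpret pair_graph G by fact
  have fiber: "card {a \<in> parcs G. edge_of a = e} \<le> 2" for e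
  proof (cases "\<exists>a. edge_of a = e")
    case True
    then obtain b where b: "edge_of b = e" ..
    have "{a \<in> parcs G. edge_of a = e} \<subseteq> set [b, (snd b, fst b)]"
      unfolding b[symmetric] edge_of_eq_iff by auto
    then have "card {a \<in> parcs G. edge_of a = e} \<le> card (set [b, (snd b, fst b)])"
      by (rule card_mono[rotated]) simp
    also have "\<dots> \<le> 2"
      using card_length[of "[b, (snd b, fst b)]"] by simp
    finally show ?thesis .
  next
    case False
    then have "{a \<in> parcs G. edge_of a = e} = {}" by blast
    then show ?thesis by (metis card.empty zero_le)
  qed
  have "card (parcs G) = card (\<Union>e\<in>uedges G. {a \<in> parcs G. edge_of a = e})"
    by (rule arg_cong[of _ _ card]) (auto simp: uedges_def)
  also have "\<dots> \<le> (\<Sum>e\<in>uedges G. card {a \<in> parcs G. edge_of a = e})"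
    by (rule card_UN_le[OF finite_uedges[OF assms]])
  also have "\<dots> \<le> (\<Sum>e\<in>uedges G. 2)"
    by (intro sum_mono fiber)
  finally show ?thesis
    by (simp add: num_edges_def)
qed

text \<open>\<open>D\<close> is the degree threshold, \<open>L\<close> the low-degree part and
  \<open>H\<close> its complement. The first bound applies Hansel's inequality to the colour classes
  at the vertices of \<open>H\<close>; the second is a degree count over \<open>H\<close>.\<close>

lemma rainbow_2_num_edges_ge:
  fixes D :: nat
  assumes G: "pair_graph G" and c: "rainbow_coloring G 2 c"
  defines "nb \<equiv> \<lambda>w. {v. (w, v) \<in> parcs G}"
  defines "L \<equiv> {v \<in> pverts G. card (nb v) \<le> D}"
  shows "L \<noteq> {} \<Longrightarrow> real (card L) * log 2 (real (card L) / (1 + real D + real D ^ 2)) \<le> real (num_edges G)"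
    and "card (pverts G) * (D + 1) \<le> card L * (D + 1) + 2 * num_edges G"
proof -
  interpret pair_graph G by (fact G)
  define H where "H = pverts G - L"
  have fin: "finite L" "finite H"
    by (auto simp: L_def H_def)
  have nb_fin: "finite (nb w)" for w
    by (rule finite_subset[OF _ pair_finite_verts]) (auto simp: nb_def dest: in_arcsD2)
  define A where "A h = {v \<in> nb h. c {h, v} = 0}" for h
  define B where "B h = {v \<in> nb h. c {h, v} \<noteq> 0}" for h
  have col: "c {u, v} < 2" if "(u, v) \<in> parcs G" for u v
  proof -
    have "{u, v} \<in> uedges G"
      unfolding uedges_def using that by (rule rev_image_eqI) (simp add: edge_of_def)
    with c show ?thesis
      by (auto simp: rainbow_coloring_def)
  qed
  \<comment> \<open>An unseparated set lies within distance two of any member \<open>s\<close>, with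
    middle vertices in \<open>L\<close>; at most \<open>1 + D + D * D\<close> vertices are reached
    this way.\<close>
  have small: "card S \<le> 1 + D + D ^ 2"
    if S: "S \<subseteq> L" "\<And>h. h \<in> H \<Longrightarrow> S \<inter> A h = {} \<or> S \<inter> B h = {}" for S
  proof (cases "S = {}")
    case False
    then obtain s where s: "s \<in> S" by blast
    with S have sL: "s \<in> L" by blast
    have "S \<subseteq> {s} \<union> nb s \<union> (\<Union>w\<in>nb s \<inter> L. nb w)"
    proof
      fix t assume t: "t \<in> S"
      show "t \<in> {s} \<union> nb s \<union> (\<Union>w\<in>nb s \<inter> L. nb w)"
      proof (rule ccontr)
        assume not: "\<not> ?thesis"
        have V: "s \<in> pverts G" "t \<in> pverts G" "s \<noteq> t" "(s, t) \<notin> parcs G"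
          using s t S(1) not by (auto simp: L_def nb_def)
        then obtain w where w: "(s, w) \<in> parcs G" "(w, t) \<in> parcs G" "c {s, w} \<noteq> c {w, t}"
          using rainbow_coloring_2D[OF c] by blast
        \<comment> \<open>A middle vertex in \<open>L\<close> would put \<open>t\<close> into the
          covering set, so \<open>w\<close> is in \<open>H\<close> and its two colour classes
          separate \<open>s\<close> from \<open>t\<close>.\<close>
        then have "w \<in> H"
          using not by (auto simp: H_def nb_def dest: in_arcsD2)
        moreover have "s \<in> nb w" "t \<in> nb w"
          using w arcs_symmetric by (auto simp: nb_def)
        moreover have "c {w, s} < 2" "c {w, t} < 2"
          using w col arcs_symmetric by blast+
        moreover have "c {w, s} \<noteq> c {w, t}"
          using w(3) by (simp add: insert_commute)
        ultimately have "s \<in> A w \<and> t \<in> B w \<or> t \<in> A w \<and> s \<in> B w"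
          unfolding A_def B_def by auto
        then show False
          using S(2)[OF \<open>w \<in> H\<close>] s t by blast
      qed
    qed
    then have "card S \<le> card ({s} \<union> nb s \<union> (\<Union>w\<in>nb s \<inter> L. nb w))"
      by (intro card_mono) (use nb_fin in auto)
    also have "\<dots> \<le> card {s} + card (nb s) + card (\<Union>w\<in>nb s \<inter> L. nb w)"
      by (meson add_mono card_Un_le le_refl order_trans)
    also have "card (\<Union>w\<in>nb s \<inter> L. nb w) \<le> (\<Sum>w\<in>nb s \<inter> L. card (nb w))"
      by (rule card_UN_le) (use nb_fin in auto)
    also have "\<dots> \<le> (\<Sum>w\<in>nb s \<inter> L. D)"
      by (rule sum_mono) (auto simp: L_def)
    also have "\<dots> \<le> D * D"
      using sL card_mono[of "nb s" "nb s \<inter> L"] nb_fin by (auto simp: L_def intro!: mult_right_mono)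
    also have "card (nb s) \<le> D"
      using sL by (simp add: L_def)
    finally show ?thesis by (simp add: power2_eq_square)
  qed simp
  define d where "d v = card {h \<in> H. v \<in> nb h}" for v
  have A_Un_B: "A h \<union> B h = nb h" for h
    by (auto simp: A_def B_def)
  have "(\<Sum>v\<in>L. (1/2) ^ card {h \<in> H. v \<in> A h \<union> B h}) \<le> real (1 + D + D ^ 2)"
    by (rule sum_half_power_le_of_unseparated_small[OF fin(2,1) _ small]) (auto simp: A_def B_def)
  then have sum_half: "(\<Sum>v\<in>L. (1/2) ^ d v) \<le> 1 + real D + real D ^ 2"
    unfolding d_def A_Un_B by simp
  \<comment> \<open>Double counting: each pair has one end in \<open>L\<close> and the other in
    \<open>H\<close>, so \<open>edge_of\<close> is injective on the pairs.\<close>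
  have "(\<Sum>v\<in>L. d v) = card (SIGMA v:L. {h \<in> H. v \<in> nb h})"
    unfolding d_def using fin by (subst card_SigmaI) auto
  also have "\<dots> \<le> num_edges G"
    unfolding num_edges_def
  proof (rule card_inj_on_le[OF _ _ finite_uedges[OF G]])
    show "inj_on edge_of (SIGMA v:L. {h \<in> H. v \<in> nb h})"
      by (auto simp: inj_on_def edge_of_eq_iff H_def)
    show "edge_of ` (SIGMA v:L. {h \<in> H. v \<in> nb h}) \<subseteq> uedges G"
      using arcs_symmetric by (auto simp: uedges_def nb_def)
  qed
  finally have sum_d: "real (\<Sum>v\<in>L. d v) \<le> real (num_edges G)"
    by (rule of_nat_mono)
  have "1 + real D + real D ^ 2 > 0"
    by (simp add: add_pos_nonneg)
  from sum_ge_log_of_sum_half_power_le[OF fin(1) _ this sum_half]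
  show "L \<noteq> {} \<Longrightarrow>
      real (card L) * log 2 (real (card L) / (1 + real D + real D ^ 2)) \<le> real (num_edges G)"
    using sum_d by (rule order_trans)
  have "card H * (D + 1) = (\<Sum>h\<in>H. D + 1)"
    by simp
  also have "\<dots> \<le> (\<Sum>h\<in>H. card (nb h))"
    by (intro sum_mono) (auto simp: H_def L_def)
  also have "\<dots> = card (SIGMA h:H. nb h)"
    using fin nb_fin by (subst card_SigmaI) auto
  also have "\<dots> \<le> card (parcs G)"
    by (intro card_mono) (auto simp: nb_def)
  also have "\<dots> \<le> 2 * num_edges G"
    by (rule card_parcs_le[OF G])
  finally have "card H * (D + 1) \<le> 2 * num_edges G" .
  moreover have "card (pverts G) = card L + card H"
  proof -
    have "L \<subseteq> pverts G"
      by (auto simp: L_def)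
    then show ?thesis
      unfolding H_def using card_mono[OF pair_finite_verts] by (simp add: card_Diff_subset fin)
  qed
  ultimately show "card (pverts G) * (D + 1) \<le> card L * (D + 1) + 2 * num_edges G"
    by (simp only: add_mult_distrib)
qed

text \<open>With \<open>D = \<lfloor>(log 2 n)\<^sup>2\<rfloor>\<close> only \<open>O (n / log n)\<close> vertices have degree above \<open>D\<close>,
  while \<open>log (1 + D + D\<^sup>2) = o (log n)\<close>.\<close>

lemma num_edges_ge_of_rainbow_2:
  fixes G :: "'a pair_pre_digraph" and x :: real
  assumes G: "pair_graph G" and c: "rainbow_coloring G 2 c"
    and n: "card (pverts G) = n" and x: "x = log 2 (real n)" "x > 2"
  shows "min (n * x) (n * (1 - 2 / x) * log 2 (n * (1 - 2 / x) / (1 + x ^ 2 + x ^ 4))) \<le> num_edges G"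
proof (cases "n * x \<le> num_edges G")
  case False
  \<comment> \<open>For \<open>n = 0\<close> the convention \<open>ln 0 = 0\<close> would give
    \<open>x = 0\<close>.\<close>
  have n0: "n > 0"
    using x by (cases "n = 0") (auto simp: log_def)
  define D where "D = nat \<lfloor>x ^ 2\<rfloor>"
  have D: "real D \<le> x ^ 2" "x ^ 2 \<le> real D + 1"
    by (auto simp: D_def)
  define l where "l = n * (1 - 2 / x)"
  define L where "L = {v \<in> pverts G. card {w. (v, w) \<in> parcs G} \<le> D}"
  have "finite (pverts G)"
    using G by (simp add: pair_graph_def pair_digraph_def pair_fin_digraph.pair_finite_verts)
  then have card_L_le: "card L \<le> n"
    unfolding n[symmetric] by (rule card_mono) (auto simp: L_def)
  \<comment> \<open>By the degree count and \<open>num_edges G < n * x\<close>, at most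
    \<open>2 * n * x / x ^ 2 = 2 * n / x\<close> vertices lie outside \<open>L\<close>.\<close>
  have lL: "l \<le> card L"
  proof -
    have "real n * (real D + 1) \<le> real (card L) * (real D + 1) + 2 * real (num_edges G)"
      using rainbow_2_num_edges_ge(2)[OF G c, of D, folded L_def, unfolded n, THEN of_nat_mono, where 'a=real]
      by (simp add: algebra_simps)
    then have "(real n - real (card L)) * (real D + 1) \<le> 2 * (n * x)"
      using False by (simp add: algebra_simps)
    moreover have "(real n - real (card L)) * x ^ 2 \<le> (real n - real (card L)) * (real D + 1)"
      using D(2) card_L_le by (intro mult_left_mono) auto
    ultimately have "(real n - real (card L)) * x ^ 2 \<le> 2 * (n * x)"
      by linarith
    then have "((real n - real (card L)) * x) * x \<le> (2 * n) * x"
      by (simp add: power2_eq_square algebra_simps)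
    then have "(real n - real (card L)) * x \<le> 2 * n"
      using x(2) by (subst (asm) mult_le_cancel_right) auto
    then show ?thesis
      using x(2) by (simp add: l_def field_simps)
  qed
  have l: "l > 0"
    using n0 x(2) by (simp add: l_def)
  define M where "M = 1 + x ^ 2 + x ^ 4"
  have "(real D) ^ 2 \<le> (x ^ 2) ^ 2"
    using D(1) by (rule power_mono) simp
  also have "(x ^ 2) ^ 2 = x ^ 4"
    by simp
  finally have M: "1 + real D + real D ^ 2 \<le> M" "M > 0"
    using D(1) unfolding M_def by (simp_all add: add_pos_nonneg)
  have D_pos: "1 + real D + real D ^ 2 > 0"
    by (simp add: add_pos_nonneg)
  have "l * log 2 (l / M) \<le> num_edges G"
  \<comment> \<open>If the logarithm is not positive the claim is trivial; otherwise both factors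
    are nonnegative and can be bounded separately.\<close>
  proof (cases "l / M \<le> 1")
    case True
    moreover have "l / M > 0"
      using l M by simp
    ultimately have "log 2 (l / M) \<le> 0"
      by (simp add: log_le_zero_cancel_iff)
    with l have "l * log 2 (l / M) \<le> 0"
      by (simp add: mult_nonneg_nonpos)
    then show ?thesis
      by linarith
  next
    case False
    have "L \<noteq> {}"
      using lL l by auto
    note num_edges_ge = rainbow_2_num_edges_ge(1)[OF G c, of D, folded L_def, OF this]
    have "l / M \<le> card L / (1 + real D + real D ^ 2)"
      using lL M l D_pos by (intro frac_le) linarith+
    moreover have "1 < l / M"
      using False by linarith
    ultimately have "log 2 (l / M) \<le> log 2 (card L / (1 + real D + real D ^ 2))" "0 \<le> log 2 (l / M)"
      by simp_all
    then have "l * log 2 (l / M) \<le> card L * log 2 (card L / (1 + real D + real D ^ 2))"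
      using lL by (intro mult_mono) simp_all
    with num_edges_ge show ?thesis
      by linarith
  qed
  then show ?thesis
    unfolding l_def M_def by linarith
qed simp

section \<open>The construction\<close>

text \<open>The vertices below \<open>m\<close> are the hubs; every other vertex \<open>v\<close> sees hub \<open>h\<close> in the colour
  given by the \<open>h\<close>-th binary digit of \<open>v\<close>.\<close>

definition hub_graph :: "nat \<Rightarrow> nat \<Rightarrow> nat pair_pre_digraph" where
  "hub_graph m n = \<lparr>pverts = {..<n}, parcs = {(u, v). u < n \<and> v < n \<and> u \<noteq> v \<and> (u < m \<or> v < m)}\<rparr>"

text \<open>Hubs are the smallest vertices, so on an edge from a hub to another vertex
  \<open>Min\<close> is the digit position and \<open>Max\<close> the number whose digit is
  read.\<close>

definition bit_coloring :: "nat set \<Rightarrow> nat" where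
  "bit_coloring e = of_bool (bit (Max e) (Min e))"

lemma pair_graph_hub_graph: "pair_graph (hub_graph m n)"
proof
  show "finite (parcs (hub_graph m n))"
    by (rule finite_subset[of _ "{..<n} \<times> {..<n}"]) (auto simp: hub_graph_def)
qed (auto simp: hub_graph_def symmetric_def sym_def)

text \<open>Distinct nonadjacent vertices are not hubs. Being below \<open>2 ^ m\<close> they differ
  in a digit \<open>h < m\<close>, so hub \<open>h\<close> joins them by edges of different
  colours.\<close>

lemma rainbow_coloring_hub_graph:
  assumes "n \<le> 2 ^ m"
  shows "rainbow_coloring (hub_graph m n) 2 bit_coloring"
proof -
  have "\<exists>p. rainbow_path (hub_graph m n) bit_coloring p \<and> hd p = u \<and> last p = v"
    if uv: "u < n" "v < n" "u \<noteq> v" for u v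
  proof (cases "(u, v) \<in> parcs (hub_graph m n)")
    case True
    from rainbow_path_pair[OF True pair_graph_hub_graph] show ?thesis
      by (intro exI[of _ "[u, v]"]) simp
  next
    case False
    then have uv_ge: "m \<le> u" "m \<le> v"
      using uv by (auto simp: hub_graph_def)
    have "take_bit m u = u" "take_bit m v = v"
      using uv assms by (simp_all add: take_bit_nat_eq_self)
    with uv(3) have "take_bit m u \<noteq> take_bit m v"
      by simp
    then obtain h where h: "h < m" "bit u h \<noteq> bit v h"
      by (auto simp: bit_eq_iff bit_take_bit_iff)
    then have "bit_coloring {u, h} \<noteq> bit_coloring {h, v}"
      using uv_ge by (simp add: bit_coloring_def)
    then have "rainbow_path (hub_graph m n) bit_coloring [u, h, v]"
      using h uv uv_ge by (intro rainbow_path_triple pair_graph_hub_graph) (auto simp: hub_graph_def)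
    then show ?thesis
      by (intro exI[of _ "[u, h, v]"]) simp
  qed
  then show ?thesis
    by (auto simp: rainbow_coloring_def bit_coloring_def hub_graph_def)
qed

lemma rainbow_coloring_imp_connected:
  assumes G: "pair_graph G" and "pverts G \<noteq> {}" "rainbow_coloring G i c"
  shows "Digraph_Component.connected (with_proj G)"
proof -
  interpret pair_graph G by (fact G)
  show ?thesis
    unfolding connected_conv
  proof (intro conjI ballI)
    fix u v assume uv: "u \<in> verts (with_proj G)" "v \<in> verts (with_proj G)"
    show "(u, v) \<in> rtrancl_on (verts (with_proj G)) ((arcs_ends (with_proj G))\<^sup>s)"
    proof (cases "u = v")
      case False
      then obtain p where "vpath p (with_proj G)" "hd p = u" "last p = v"
        using assms(3) uv unfolding rainbow_coloring_def rainbow_path_def with_proj_simps by blast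
      then have "u \<rightarrow>\<^sup>*\<^bsub>with_proj G\<^esub> v"
        using reachable_vpath_conv by blast
      then show ?thesis
        unfolding reachable_def by (rule rtrancl_on_mono[rotated 2]) (auto simp: symcl_def)
    qed (use uv in auto)
  qed (use assms in auto)
qed

text \<open>By \<open>m + 2 \<le> n\<close> there are two non-hubs \<open>m\<close> and
  \<open>m + 1\<close>; they are nonadjacent, so one colour is not enough.\<close>

lemma hub_graph_in_rc_graphs:
  assumes "n \<le> 2 ^ m" "m + 2 \<le> n"
  shows "hub_graph m n \<in> rc_graphs 2 n"
proof -
  note col = rainbow_coloring_hub_graph[OF assms(1)]
  have "rc (hub_graph m n) = 2"
    unfolding rc_def
  proof (rule Least_equality)
    fix i assume "\<exists>c. rainbow_coloring (hub_graph m n) i c"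
    then obtain c where c: "rainbow_coloring (hub_graph m n) i c" ..
    show "2 \<le> i"
    proof (rule ccontr)
      assume "\<not> 2 \<le> i"
      then have "(m, m + 1) \<in> parcs (hub_graph m n)"
        using assms(2) by (intro rainbow_coloring_small_complete[OF c]) (auto simp: hub_graph_def)
      then show False by (simp add: hub_graph_def)
    qed
  qed (use col in blast)
  moreover have "Digraph_Component.connected (with_proj (hub_graph m n))"
    by (rule rainbow_coloring_imp_connected[OF pair_graph_hub_graph _ col])
      (use assms in \<open>simp add: hub_graph_def lessThan_empty_iff\<close>)
  ultimately show ?thesis
    using pair_graph_hub_graph by (simp add: rc_graphs_def hub_graph_def)
qed

lemma num_edges_hub_graph: "num_edges (hub_graph m n) \<le> m * n"
proof -
  have "uedges (hub_graph m n) \<subseteq> edge_of ` ({..<m} \<times> {..<n})"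
  proof
    fix e assume "e \<in> uedges (hub_graph m n)"
    then obtain u v where e: "e = edge_of (u, v)" "e = edge_of (v, u)"
      and "u < n" "v < n" "u < m \<or> v < m"
      by (auto simp: uedges_def hub_graph_def edge_of_eq_iff)
    then have "(u, v) \<in> {..<m} \<times> {..<n} \<or> (v, u) \<in> {..<m} \<times> {..<n}"
      by auto
    with e show "e \<in> edge_of ` ({..<m} \<times> {..<n})"
      by blast
  qed
  then have "num_edges (hub_graph m n) \<le> card (edge_of ` ({..<m} \<times> {..<n}))"
    unfolding num_edges_def by (intro card_mono) auto
  also have "\<dots> \<le> card ({..<m} \<times> {..<n})"
    by (intro card_image_le) auto
  finally show ?thesis by simp
qed

section \<open>Squeezing the minimum between the two bounds\<close>

lemma log2_bounds_nat:
  assumes "n > 0"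
  obtains m where "n \<le> 2 ^ m" "real m < log 2 (real n) + 1"
proof
  have "real n = 2 powr log 2 (real n)"
    using assms by simp
  also have "\<dots> \<le> 2 powr real (nat \<lceil>log 2 (real n)\<rceil>)"
    by (intro powr_mono) linarith+
  finally have "real n \<le> real (2 ^ nat \<lceil>log 2 (real n)\<rceil>)"
    by (simp add: powr_realpow)
  then show "n \<le> 2 ^ nat \<lceil>log 2 (real n)\<rceil>"
    by (simp only: of_nat_le_iff)
  show "real (nat \<lceil>log 2 (real n)\<rceil>) < log 2 (real n) + 1"
    using assms ceiling_correct[of "log 2 (real n)"] by simp
qed

text \<open>The hub graph shows that the minimum is attained and bounds it above. A minimising graph
  has a rainbow colouring with two colours, so the lower bound applies to it.\<close>

lemma min_edges_rc_2_bounds: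
  fixes x :: real
  assumes "n > 0" and x: "x = log 2 (real n)" "x > 2" "x + 3 \<le> n"
  shows "min (n * x) (n * (1 - 2 / x) * log 2 (n * (1 - 2 / x) / (1 + x ^ 2 + x ^ 4))) \<le> min_edges_rc 2 n"
    and "min_edges_rc 2 n \<le> n * (x + 1)"
proof -
  obtain m where m: "n \<le> 2 ^ m" "real m < x + 1"
    using log2_bounds_nat[OF assms(1)] unfolding x(1) .
  \<comment> \<open>From \<open>m < x + 1\<close> and \<open>x + 3 \<le> n\<close> follows
    \<open>m + 2 \<le> n\<close>.\<close>
  have in_rc: "hub_graph m n \<in> rc_graphs 2 n"
    using m x by (intro hub_graph_in_rc_graphs) linarith+
  then have "\<exists>G\<in>rc_graphs 2 n. num_edges G = min_edges_rc 2 n"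
    unfolding min_edges_rc_def
    by (intro LeastI[of "\<lambda>k. \<exists>G\<in>rc_graphs 2 n. num_edges G = k" "num_edges (hub_graph m n)"]) blast
  then obtain G where G: "G \<in> rc_graphs 2 n" "num_edges G = min_edges_rc 2 n" by blast
  from G(1) have G': "pair_graph G" "Digraph_Component.connected (with_proj G)"
    "card (pverts G) = n" "rc G = 2"
    by (simp_all add: rc_graphs_def)
  obtain c where "rainbow_coloring G 2 c"
    using rc_eq_2D[OF G'(1,2,4)] .
  from num_edges_ge_of_rainbow_2[OF G'(1) this G'(3) x(1,2)] G(2)
  show "min (n * x) (n * (1 - 2 / x) * log 2 (n * (1 - 2 / x) / (1 + x ^ 2 + x ^ 4))) \<le> min_edges_rc 2 n"
    by (simp only:)
  have "min_edges_rc 2 n \<le> num_edges (hub_graph m n)"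
    unfolding min_edges_rc_def by (rule Least_le) (use in_rc in blast)
  also have "\<dots> \<le> m * n"
    by (rule num_edges_hub_graph)
  finally have "real (min_edges_rc 2 n) \<le> real m * real n"
    by (metis of_nat_le_iff of_nat_mult)
  also have "\<dots> \<le> (x + 1) * real n"
    using m by (intro mult_right_mono) auto
  finally show "min_edges_rc 2 n \<le> n * (x + 1)"
    by (simp add: mult.commute)
qed

theorem theorem3:
  shows "(\<lambda>n. real (min_edges_rc 2 n) / (real n * log 2 (real n))) \<longlonglongrightarrow> 1"
proof (rule tendsto_sandwich)
  let ?lower = "\<lambda>n. min (n * log 2 n) (n * (1 - 2 / log 2 n) *
    log 2 (n * (1 - 2 / log 2 n) / (1 + log 2 n ^ 2 + log 2 n ^ 4))) / (n * log 2 n) :: real"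
  have large: "\<forall>\<^sub>F n in sequentially. n > 0 \<and> log 2 (real n) > 2 \<and> log 2 (real n) + 3 \<le> real n"
    by (intro eventually_conj eventually_gt_at_top; real_asymp)
  then show "\<forall>\<^sub>F n in sequentially. ?lower (real n) \<le> min_edges_rc 2 n / (real n * log 2 (real n))"
    by eventually_elim (intro divide_right_mono min_edges_rc_2_bounds(1)[OF _ refl], auto)
  from large show "\<forall>\<^sub>F n in sequentially.
      min_edges_rc 2 n / (real n * log 2 (real n)) \<le> real n * (log 2 (real n) + 1) / (real n * log 2 (real n))"
    by eventually_elim (intro divide_right_mono min_edges_rc_2_bounds(2)[OF _ refl], auto)
  \<comment> \<open>With \<open>x = log 2 n\<close>, the second term of the minimum over
    \<open>n * x\<close> tends to 1, because \<open>log 2 (1 + x ^ 2 + x ^ 4)\<close> is of order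
    \<open>log 2 x\<close>; the first term gives exactly 1.\<close>
  show "(\<lambda>n. ?lower (real n)) \<longlonglongrightarrow> 1"
    by real_asymp
  show "(\<lambda>n. real n * (log 2 (real n) + 1) / (real n * log 2 (real n))) \<longlonglongrightarrow> 1"
    by real_asymp
qed

end
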